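(* Let $\rho\in[-1,0)\cup(0,+\infty)$ be fixed and let $\{y(t),p_0(t),p(t)\mid t=1,\dots,T\}$ be time series with $y(t)\ge0$, $p_0(t)>0$, $p(t)=(p_1(t),p_2(t))>0$. Let $\lambda=(\lambda(1),\dots,\lambda(T))\in S_T$ be a permutation such that $$y(\lambda(T))<\cdots<y(\lambda(1)).$$ If the rhombic tiling corresponding to the partition $\Lambda\{\widetilde p(t,\rho)\mid t=1,\dots,T\}$ has the snake $Sn(\lambda)$, then the moment problem $$\int_{\mathbb R^2_+}\theta\Bigl(p_0(t)-\bigl(p_1(t)^{-\rho}x_1^{-\rho}+p_2(t)^{-\rho}x_2^{-\rho}\bigr)^{-\frac1\rho}\Bigr)\mu(dx)=y(t)\qquad(t=1,\dots,T)$$ is solvable in the class of non-negative absolutely continuous measures $\mu(dx)$.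
   Context: $\theta(s)=1$ for $s\ge0$ and $\theta(s)=0$ for $s<0$. Put $\widehat p_i(t)=p_i(t)/p_0(t)$, $i=1,2$. For $\rho\in[-1,0)$ put $\widetilde p_i(t,\rho)=\widehat p_i(t)^{-\rho}$. For $\rho\in(0,+\infty)$ put $\widetilde p_i(t,\rho)=\tfrac1\varepsilon-\widehat p_i(t)^{-\rho}$, where $\varepsilon>0$ is fixed so small that $\widehat p_1(t)^{-\rho}<\tfrac1\varepsilon$, $\widehat p_2(t)^{-\rho}<\tfrac1\varepsilon$ for all $t$, and $\bigl(\widehat p_1(t)^{-\rho}x_1^{-\rho}+\widehat p_2(t)^{-\rho}x_2^{-\rho}\bigr)^{-1/\rho}>1$ for all $t$ whenever $x_1^{-\rho}+x_2^{-\rho}\le\varepsilon$. Numbering: the indices are numbered so that $\widetilde p_1(1,\rho)<\dots<\widetilde p_1(T,\rho)$, and the values $\widetilde p_2(t,\rho)$ are pairwise distinct. $\Lambda\{\widetilde p(t,\rho)\mid t=1,\dots,T\}$ is the partition (set of domains) of $\mathbb R^2_+$ cut out by the lines $\widetilde p_1(t,\rho)z_1+\widetilde p_2(t,\rho)z_2=1$, $t=1,\dots,T$. For $\alpha\in(0,\tfrac\pi2)$ let $R_\alpha=\{(z_1,z_2)\in\mathbb R^2_+\mid z_2=z_1\tan\alpha\}$. Standing assumptions: no three of the lines have a common point, and each $R_\alpha$ meets at most one intersection point of the lines. Let $\alpha_1<\dots<\alpha_N$ be all $\alpha\in(0,\tfrac\pi2)$ for which $R_\alpha$ meets an intersection point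 of the lines. For $\alpha\in(0,\tfrac\pi2)\setminus\{\alpha_1,\dots,\alpha_N\}$ let $\pi(\alpha)=(\pi_1(\alpha),\dots,\pi_T(\alpha))\in S_T$ be the order in which the lines are met along $R_\alpha$ as $z_1$ decreases from $+\infty$ to $0$. Fix $\xi_j=(j-\lfloor T/2\rfloor,1)\in\mathbb R^2$, $j=1,\dots,T$. For a permutation $\lambda\in S_T$ the snake $Sn(\lambda)$ is the polygonal chain $\overline{V_1(\lambda)\cdots V_{T+1}(\lambda)}$ with $V_k(\lambda)=\xi_{\lambda(k)}+\xi_{\lambda(k+1)}+\cdots+\xi_{\lambda(T)}$ for $k=1,\dots,T$ and $V_{T+1}(\lambda)=0$. For $\alpha\in(0,\tfrac\pi2)\setminus\{\alpha_1,\dots,\alpha_N\}$ put $Sn(\alpha)=Sn(\pi(\alpha))$. When $\alpha$ crosses $\alpha_i$, exactly one vertex of the snake changes, and the old and new positions of this vertex together with its two neighbours in the chain form a rhombus. The rhombic tiling corresponding to the partition is the collection of all snakes $Sn(\alpha)$, $\alpha\in(0,\tfrac\pi2)\setminus\{\alpha_1,\dots,\alpha_N\}$, together with these rhombuses. The tiling has the snake $Sn(\lambda)$ if $Sn(\lambda)=Sn(\alpha)$ for some such $\alpha$. *)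

theory Defs
  imports "HOL-Analysis.Analysis" "HOL-Combinatorics.Permutations"
begin

definition theta :: "real \<Rightarrow> real" where
  "theta s = (if s \<ge> 0 then 1 else 0)"

definition R2plus :: "(real \<times> real) set" where
  "R2plus = {z. 0 \<le> fst z \<and> 0 \<le> snd z}"

text \<open>
  The function (p1^(-rho) x1^(-rho) + p2^(-rho) x2^(-rho))^(-1/rho) on the closed quadrant.
  For rho > 0 and x1 = 0 or x2 = 0 the inner sum is infinite, so the value is 0; this has to be
  said explicitly because \<^term>\<open>0 powr a = (0::real)\<close> also for negative exponents.
\<close>
definition ces :: "real \<Rightarrow> real \<times> real \<Rightarrow> real \<times> real \<Rightarrow> real" where
  "ces \<rho> p x =
     (if \<rho> > 0 \<and> (fst x = 0 \<or> snd x = 0) then 0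
      else (fst p powr (-\<rho>) * fst x powr (-\<rho>) + snd p powr (-\<rho>) * snd x powr (-\<rho>)) powr (-1/\<rho>))"

definition p_hat :: "(nat \<Rightarrow> real) \<Rightarrow> (nat \<Rightarrow> real \<times> real) \<Rightarrow> nat \<Rightarrow> real \<times> real" where
  "p_hat p0 p t = (fst (p t) / p0 t, snd (p t) / p0 t)"

text \<open>
  The requirement on the constant used when rho > 0. The point x ranges over the open quadrant
  only: on the boundary x1^(-rho) + x2^(-rho) is infinite, hence not bounded by \<open>\<epsilon>\<close>.
\<close>
definition admissible_eps ::
  "nat \<Rightarrow> real \<Rightarrow> (nat \<Rightarrow> real) \<Rightarrow> (nat \<Rightarrow> real \<times> real) \<Rightarrow> real \<Rightarrow> bool" where
  "admissible_eps T \<rho> p0 p \<epsilon> \<longleftrightarrow>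
     \<epsilon> > 0 \<and>
     (\<forall>t\<in>{1..T}. fst (p_hat p0 p t) powr (-\<rho>) < 1/\<epsilon> \<and> snd (p_hat p0 p t) powr (-\<rho>) < 1/\<epsilon>) \<and>
     (\<forall>t\<in>{1..T}. \<forall>x1>0. \<forall>x2>0. x1 powr (-\<rho>) + x2 powr (-\<rho>) \<le> \<epsilon> \<longrightarrow>
        ces \<rho> (p_hat p0 p t) (x1, x2) > 1)"

definition p_tilde ::
  "real \<Rightarrow> real \<Rightarrow> (nat \<Rightarrow> real) \<Rightarrow> (nat \<Rightarrow> real \<times> real) \<Rightarrow> nat \<Rightarrow> real \<times> real" where
  "p_tilde \<rho> \<epsilon> p0 p t =
     (if \<rho> < 0
      then (fst (p_hat p0 p t) powr (-\<rho>), snd (p_hat p0 p t) powr (-\<rho>))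
      else (1/\<epsilon> - fst (p_hat p0 p t) powr (-\<rho>), 1/\<epsilon> - snd (p_hat p0 p t) powr (-\<rho>)))"

text \<open>
  Below, \<open>q 1, \<dots>, q T\<close> are the coefficient vectors of the lines that cut the quadrant
  into domains; in the theorem \<open>q\<close> is \<^const>\<open>p_tilde\<close>.
\<close>

definition line :: "real \<times> real \<Rightarrow> (real \<times> real) set" where
  "line c = {z. fst c * fst z + snd c * snd z = 1}"

definition ray :: "real \<Rightarrow> (real \<times> real) set" where
  "ray \<alpha> = {z \<in> R2plus. snd z = fst z * tan \<alpha>}"

definition intersection_points :: "nat \<Rightarrow> (nat \<Rightarrow> real \<times> real) \<Rightarrow> (real \<times> real) set" where
  "intersection_points T q =
     {z. \<exists>s\<in>{1..T}. \<exists>t\<in>{1..T}. s \<noteq> t \<and> z \<in> line (q s) \<and> z \<in> line (q t)}"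

definition well_numbered :: "nat \<Rightarrow> (nat \<Rightarrow> real \<times> real) \<Rightarrow> bool" where
  "well_numbered T q \<longleftrightarrow>
     strict_mono_on {1..T} (\<lambda>t. fst (q t)) \<and> inj_on (\<lambda>t. snd (q t)) {1..T}"

definition general_position :: "nat \<Rightarrow> (nat \<Rightarrow> real \<times> real) \<Rightarrow> bool" where
  "general_position T q \<longleftrightarrow>
     (\<forall>r\<in>{1..T}. \<forall>s\<in>{1..T}. \<forall>t\<in>{1..T}. r \<noteq> s \<and> s \<noteq> t \<and> r \<noteq> t \<longrightarrow>
        line (q r) \<inter> line (q s) \<inter> line (q t) = {}) \<and>
     (\<forall>\<alpha>\<in>{0<..<pi/2}. \<forall>z\<in>ray \<alpha> \<inter> intersection_points T q.
        \<forall>w\<in>ray \<alpha> \<inter> intersection_points T q. z = w)"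

definition critical_angles :: "nat \<Rightarrow> (nat \<Rightarrow> real \<times> real) \<Rightarrow> real set" where
  "critical_angles T q = {\<alpha>\<in>{0<..<pi/2}. ray \<alpha> \<inter> intersection_points T q \<noteq> {}}"

definition regular_angles :: "nat \<Rightarrow> (nat \<Rightarrow> real \<times> real) \<Rightarrow> real set" where
  "regular_angles T q = {0<..<pi/2} - critical_angles T q"

text \<open>
  The z1-coordinate of the point where the ray meets the line. The point is unique for lines with
  positive coefficients, which is the only case in which this is used.
\<close>
definition meeting_abscissa :: "real \<Rightarrow> real \<times> real \<Rightarrow> real" where
  "meeting_abscissa \<alpha> c = (THE z1. \<exists>z2. (z1, z2) \<in> ray \<alpha> \<inter> line c)"

definition line_order :: "nat \<Rightarrow> (nat \<Rightarrow> real \<times> real) \<Rightarrow> real \<Rightarrow> nat \<Rightarrow> nat" where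
  "line_order T q \<alpha> =
     (THE \<pi>. \<pi> permutes {1..T} \<and>
        (\<forall>j\<in>{1..T}. \<forall>k\<in>{1..T}. j < k \<longrightarrow>
           meeting_abscissa \<alpha> (q (\<pi> k)) < meeting_abscissa \<alpha> (q (\<pi> j))))"

definition xi :: "nat \<Rightarrow> nat \<Rightarrow> real \<times> real" where
  "xi T j = (real j - real (T div 2), 1)"

text \<open>For \<open>k = T + 1\<close> the sum is empty, so the last vertex is the origin.\<close>
definition snake_vertex :: "nat \<Rightarrow> (nat \<Rightarrow> nat) \<Rightarrow> nat \<Rightarrow> real \<times> real" where
  "snake_vertex T l k = (\<Sum>j\<in>{k..T}. xi T (l j))"

text \<open>A polygonal chain is given by the list of its consecutive vertices.\<close>
definition snake :: "nat \<Rightarrow> (nat \<Rightarrow> nat) \<Rightarrow> (real \<times> real) list" where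
  "snake T l = map (snake_vertex T l) [1..<T + 2]"

record rhombic_tiling =
  snakes :: "(real \<times> real) list set"
  rhombuses :: "(real \<times> real) set set"

text \<open>
  A rhombus arises from two regular angles separated by exactly one critical angle: it is spanned
  by the old and the new position of a vertex that changes, together with its two neighbours.
\<close>
definition tiling :: "nat \<Rightarrow> (nat \<Rightarrow> real \<times> real) \<Rightarrow> rhombic_tiling" where
  "tiling T q =
     \<lparr> snakes = (\<lambda>\<alpha>. snake T (line_order T q \<alpha>)) ` regular_angles T q,
       rhombuses =
         {convex hull {snake_vertex T l (k - 1), snake_vertex T l k,
                       snake_vertex T l (k + 1), snake_vertex T l' k} | l l' k.
            \<exists>\<alpha>\<in>regular_angles T q. \<exists>\<beta>\<in>regular_angles T q. \<alpha> < \<beta> \<and>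
              (\<exists>!\<gamma>. \<gamma> \<in> critical_angles T q \<and> \<alpha> < \<gamma> \<and> \<gamma> < \<beta>) \<and>
              l = line_order T q \<alpha> \<and> l' = line_order T q \<beta> \<and>
              k \<in> {2..T} \<and> snake_vertex T l k \<noteq> snake_vertex T l' k} \<rparr>"

definition has_snake :: "rhombic_tiling \<Rightarrow> (real \<times> real) list \<Rightarrow> bool" where
  "has_snake R S \<longleftrightarrow> S \<in> snakes R"

text \<open>
  Sigma-finiteness makes absolute continuity mean possession of a density
  (Radon-Nikodym). \<^const>\<open>has_bochner_integral\<close> includes integrability, so that a divergent
  integral is not counted as 0.
\<close>
definition moment_problem_solvable ::
  "nat \<Rightarrow> real \<Rightarrow> (nat \<Rightarrow> real) \<Rightarrow> (nat \<Rightarrow> real) \<Rightarrow> (nat \<Rightarrow> real \<times> real) \<Rightarrow> bool" where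
  "moment_problem_solvable T \<rho> y p0 p \<longleftrightarrow>
     (\<exists>\<mu> :: (real \<times> real) measure.
        sets \<mu> = sets (restrict_space lborel R2plus) \<and>
        sigma_finite_measure \<mu> \<and>
        absolutely_continuous (restrict_space lborel R2plus) \<mu> \<and>
        (\<forall>t\<in>{1..T}. has_bochner_integral \<mu> (\<lambda>x. theta (p0 t - ces \<rho> (p t) x)) (y t)))"

end

theory Submission
  imports Defs
begin

text \<open>
  The function \<^const>\<open>ces\<close> is homogeneous of degree one, and on the curve that the substitution
  \<open>z_i = x_i^(-\<rho>)\<close> turns into the ray \<open>R_\<alpha>\<close>, itself a ray, the \<open>t\<close>-th integrand is the
  indicator of an initial segment. The endpoints of these segments are ordered as the points in
  which \<open>R_\<alpha>\<close> meets the lines, that is, by \<open>l\<close>: for positive \<open>\<rho>\<close> the passage to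
  \<open>1/\<epsilon> - p^(-\<rho>)\<close> reverses the order, and so does the exponent \<open>-1/\<rho>\<close>. Spreading mass
  \<open>y (l k) - y (l (k + 1))\<close> over a small ball around a point between the \<open>(k + 1)\<close>-st and the
  \<open>k\<close>-th endpoint gives the moments by telescoping.
\<close>

section \<open>Absolutely continuous measures with prescribed integrals\<close>

text \<open>The density spreads mass \<open>m k\<close> uniformly over \<open>B k\<close>. Since
  \<open>f t\<close> is constant there, this contributes \<open>m k * c t k\<close>; contributions
  add up even where the sets overlap.\<close>

lemma ex_absolutely_continuous_measure_with_integrals:
  fixes S :: "'a::euclidean_space set" and B :: "'k \<Rightarrow> 'a set" and f :: "'t \<Rightarrow> 'a \<Rightarrow> real"
  assumes "S \<in> sets borel" "finite K"
    and B: "\<And>k. k \<in> K \<Longrightarrow> open (B k) \<and> bounded (B k) \<and> B k \<noteq> {} \<and> B k \<subseteq> S"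
    and m: "\<And>k. k \<in> K \<Longrightarrow> 0 \<le> m k"
    and f: "\<And>t. t \<in> I \<Longrightarrow> f t \<in> borel_measurable borel"
    and c: "\<And>t k x. t \<in> I \<Longrightarrow> k \<in> K \<Longrightarrow> x \<in> B k \<Longrightarrow> f t x = c t k"
  shows "\<exists>\<mu>. sets \<mu> = sets (restrict_space lborel S) \<and> sigma_finite_measure \<mu> \<and>
    absolutely_continuous (restrict_space lborel S) \<mu> \<and>
    (\<forall>t\<in>I. has_bochner_integral \<mu> (f t) (\<Sum>k\<in>K. m k * c t k))"
proof -
  let ?L = "restrict_space lborel S"
  define g where "g x = (\<Sum>k\<in>K. m k / measure lborel (B k) * indicator (B k) x)" for x
  have B_borel: "B k \<in> sets borel" if "k \<in> K" for k
    using B[OF that] by auto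
  have g_meas: "g \<in> borel_measurable ?L"
    unfolding g_def using B_borel
    by (intro measurable_restrict_space1) (auto intro!: borel_measurable_sum)
  have g_nonneg: "0 \<le> g x" for x
    unfolding g_def using m by (intro sum_nonneg) simp
  have vol: "0 < measure lborel (B k)" "emeasure lborel (B k) < \<infinity>" if "k \<in> K" for k
  proof -
    show fin: "emeasure lborel (B k) < \<infinity>"
      using B[OF that] emeasure_bounded_finite by auto
    \<comment> \<open>A non-empty open set is not negligible; the completion links
      \<open>negligible\<close> to the null sets of \<open>lborel\<close>.\<close>
    have "emeasure lborel (B k) \<noteq> 0"
      using B[OF that] B_borel[OF that] open_not_negligible[of "B k"] null_sets_completionI[of "B k" lborel]
      by (auto simp: negligible_iff_null_sets null_sets_def)
    then show "0 < measure lborel (B k)"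
      using fin by (simp add: measure_def enn2real_positive_iff zero_less_iff_neq_zero top.not_eq_extremum)
  qed
  have B_int: "has_bochner_integral ?L (\<lambda>x. indicator (B k) x :: real) (measure lborel (B k))"
    if "k \<in> K" for k
  proof -
    have "has_bochner_integral ?L (indicator (B k) :: 'a \<Rightarrow> real) (measure ?L (B k))"
      using B[OF that] B_borel[OF that] vol[OF that] assms(1)
      by (intro has_bochner_integral_real_indicator)
         (auto simp: emeasure_restrict_space sets_restrict_space_iff)
    then show ?thesis
      using B[OF that] assms(1) by (simp add: measure_restrict_space)
  qed
  \<comment> \<open>Values of \<open>h\<close> outside the sets \<open>B k\<close> do not matter,
    because \<open>g\<close> vanishes there.\<close>
  have weighted: "has_bochner_integral ?L (\<lambda>x. g x *\<^sub>R h x) (\<Sum>k\<in>K. m k * d k)"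
    if "\<And>k x. k \<in> K \<Longrightarrow> x \<in> B k \<Longrightarrow> h x = d k" for h d
  proof -
    have eq: "(\<lambda>x. g x *\<^sub>R h x) =
        (\<lambda>x. \<Sum>k\<in>K. m k * d k / measure lborel (B k) * indicator (B k) x)"
      unfolding g_def using that
      by (auto simp: sum_distrib_right fun_eq_iff indicator_def intro!: sum.cong)
    have "has_bochner_integral ?L (\<lambda>x. g x *\<^sub>R h x)
        (\<Sum>k\<in>K. m k * d k / measure lborel (B k) * measure lborel (B k))"
      unfolding eq by (intro has_bochner_integral_sum has_bochner_integral_mult_right B_int)
    moreover have "m k * d k / measure lborel (B k) * measure lborel (B k) = m k * d k"
      if "k \<in> K" for k
      using vol[OF that] by simp
    ultimately show ?thesis by (simp cong: sum.cong)
  qed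
  let ?\<mu> = "density ?L g"
  have int: "has_bochner_integral ?\<mu> h (\<Sum>k\<in>K. m k * d k)"
    if "h \<in> borel_measurable borel" "\<And>k x. k \<in> K \<Longrightarrow> x \<in> B k \<Longrightarrow> h x = d k" for h d
    using that weighted[of h d] g_meas g_nonneg
    by (intro has_bochner_integral_density) (auto intro: measurable_restrict_space1)
  \<comment> \<open>The case \<open>h = 1\<close> shows that the total mass is finite, whence
    sigma-finiteness.\<close>
  have "has_bochner_integral ?\<mu> (\<lambda>_. 1 :: real) (\<Sum>k\<in>K. m k * 1)"
    by (rule int) auto
  then have "integrable ?\<mu> (\<lambda>_. 1 :: real)"
    by (simp add: has_bochner_integral_iff)
  then have "(\<integral>\<^sup>+ x. 1 \<partial>?\<mu>) < \<infinity>"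
    by (simp add: integrable_iff_bounded)
  then have "finite_measure ?\<mu>"
    by (intro finite_measureI) simp
  then have "sigma_finite_measure ?\<mu>"
    by (simp add: finite_measure_def)
  moreover have "absolutely_continuous ?L ?\<mu>"
    using g_meas by (intro absolutely_continuousI_density) simp
  moreover have "has_bochner_integral ?\<mu> (f t) (\<Sum>k\<in>K. m k * c t k)" if "t \<in> I" for t
    by (rule int[OF f[OF that] c[OF that]])
  ultimately show ?thesis
    by (intro exI[of _ ?\<mu>]) simp
qed

section \<open>Homogeneity, continuity and measurability of the integrands\<close>

text \<open>The factor \<open>r powr (-\<rho>)\<close> leaves the inner sum, and the outer exponent
  \<open>-1/\<rho>\<close> turns it into \<open>r\<close>. Hence moving along a ray rescales all the
  functions alike.\<close>

lemma ces_scale: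
  assumes "\<rho> \<noteq> 0" "0 < r" "0 < fst p" "0 < snd p" "0 < fst x" "0 < snd x"
  shows "ces \<rho> p (r *\<^sub>R x) = r * ces \<rho> p x"
proof -
  have "ces \<rho> p (r *\<^sub>R x) =
      (r powr (-\<rho>) * (fst p powr (-\<rho>) * fst x powr (-\<rho>) + snd p powr (-\<rho>) * snd x powr (-\<rho>)))
        powr (-1/\<rho>)"
    using assms by (simp add: ces_def powr_mult algebra_simps)
  also have "\<dots> = r * ces \<rho> p x"
    using assms by (simp add: ces_def powr_mult powr_powr)
  finally show ?thesis .
qed

lemma isCont_ces:
  assumes "0 < fst p" "0 < snd p" "0 < fst x" "0 < snd x"
  shows "isCont (ces \<rho> p) x"
proof -
  let ?f = "\<lambda>x. (fst p powr (-\<rho>) * fst x powr (-\<rho>) + snd p powr (-\<rho>) * snd x powr (-\<rho>)) powr (-1/\<rho>)"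
  \<comment> \<open>The boundary case in the definition of \<open>ces\<close> does not occur near an
    interior point, so continuity can be read off from the formula.\<close>
  have "open {x :: real \<times> real. 0 < fst x \<and> 0 < snd x}"
    by (intro open_Collect_conj open_Collect_less continuous_intros)
  then have "\<forall>\<^sub>F x in nhds x. ces \<rho> p x = ?f x"
    unfolding eventually_nhds using assms by (fastforce simp: ces_def)
  moreover have "fst p powr (-\<rho>) * fst x powr (-\<rho>) + snd p powr (-\<rho>) * snd x powr (-\<rho>) > 0"
    using assms by (intro add_pos_pos) auto
  then have "isCont ?f x"
    using assms by (intro continuous_intros) auto
  ultimately show ?thesis
    using isCont_cong by fastforce
qed

lemma borel_measurable_ces [measurable]: "ces \<rho> p \<in> borel_measurable borel"
proof -
  have [measurable]: "fst \<in> borel_measurable (borel :: (real \<times> real) measure)"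
    "snd \<in> borel_measurable (borel :: (real \<times> real) measure)"
    by (intro borel_measurable_continuous_onI continuous_intros)+
  show ?thesis unfolding ces_def[abs_def] by measurable
qed

lemma borel_measurable_theta [measurable]: "theta \<in> borel_measurable borel"
  unfolding theta_def[abs_def] by measurable

section \<open>Snakes and decreasing enumerations\<close>

text \<open>Consecutive vertices differ by \<open>xi T (l k)\<close>, and \<open>xi T\<close> is
  injective, so the chain determines the permutation.\<close>

lemma snake_eq_imp_eq:
  assumes "snake T l = snake T l'" "k \<in> {1..T}"
  shows "l k = l' k"
proof -
  \<comment> \<open>The range includes the last vertex \<open>T + 1\<close>, which the case
    \<open>k = T\<close> compares with.\<close>
  have vertex: "snake_vertex T l i = snake_vertex T l' i" if "i \<in> {1..T + 1}" for i
    using assms(1) that by (auto simp: snake_def simp del: upt_Suc)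
  have step: "snake_vertex T h k = xi T (h k) + snake_vertex T h (k + 1)" for h
    using assms(2) unfolding snake_vertex_def
    by (simp add: sum.atLeast_Suc_atMost)
  have "xi T (l k) = xi T (l' k)"
    using step[of l] step[of l'] vertex[of k] vertex[of "k + 1"] assms(2) by simp
  then show ?thesis by (simp add: xi_def)
qed

text \<open>This makes the definite description in \<open>line_order\<close> meaningful. Sorting
  gives existence; uniqueness holds because a strictly sorted list is determined by its set.\<close>

lemma ex1_decreasing_permutation:
  fixes f :: "nat \<Rightarrow> real"
  assumes inj: "inj_on f {1..T}"
  shows "\<exists>!\<pi>. \<pi> permutes {1..T} \<and> (\<forall>j\<in>{1..T}. \<forall>k\<in>{1..T}. j < k \<longrightarrow> f (\<pi> k) < f (\<pi> j))"
    (is "\<exists>!\<pi>. ?P \<pi>")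
proof (rule ex_ex1I)
  \<comment> \<open>The sign turns ascending sorting into decreasing values of \<open>f\<close>;
    list positions start at 0, hence the shift \<open>k - 1\<close> in \<open>\<pi>\<close>.\<close>
  define xs where "xs = sort_key (\<lambda>t. - f t) [1..<T + 1]"
  have xs: "length xs = T" "distinct xs" "set xs = {1..T}" "sorted (map (\<lambda>t. - f t) xs)"
    by (auto simp: xs_def)
  define \<pi> where "\<pi> k = (if k \<in> {1..T} then xs ! (k - 1) else k)" for k
  have mem: "\<pi> k \<in> {1..T}" if "k \<in> {1..T}" for k
  proof -
    have "k - 1 < length xs" using xs(1) that by auto
    then have "xs ! (k - 1) \<in> {1..T}" using xs(3) nth_mem by blast
    then show ?thesis using that by (simp add: \<pi>_def)
  qed
  have inj_pi: "inj_on \<pi> {1..T}"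
    using xs by (intro inj_onI) (auto simp: \<pi>_def nth_eq_iff_index_eq)
  have "\<pi> permutes {1..T}"
  proof (rule bij_imp_permutes)
    have "\<pi> ` {1..T} = {1..T}"
      using inj_pi mem by (intro endo_inj_surj) auto
    then show "bij_betw \<pi> {1..T} {1..T}"
      using inj_pi by (simp add: bij_betw_def)
  qed (auto simp: \<pi>_def)
  moreover have "f (\<pi> k) < f (\<pi> j)" if "j \<in> {1..T}" "k \<in> {1..T}" "j < k" for j k
  proof -
    have "f (\<pi> k) \<le> f (\<pi> j)"
      using sorted_nth_mono[OF xs(4), of "j - 1" "k - 1"] that xs(1) by (auto simp: \<pi>_def)
    moreover have "f (\<pi> k) \<noteq> f (\<pi> j)"
      using inj inj_pi mem that by (metis inj_onD less_irrefl)
    ultimately show ?thesis by simp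
  qed
  ultimately show "\<exists>\<pi>. ?P \<pi>" by blast
next
  fix \<pi> \<pi>' assume P: "?P \<pi>" "?P \<pi>'"
  have sorted: "sorted_wrt (<) (map (\<lambda>k. - f (h k)) [1..<T + 1])" if "?P h" for h
    using that by (auto simp: sorted_wrt_iff_nth_less simp del: upt_Suc)
  have set: "set (map (\<lambda>k. - f (h k)) [1..<T + 1]) = (\<lambda>t. - f t) ` {1..T}" if "?P h" for h
  proof -
    have "set (map (\<lambda>k. - f (h k)) [1..<T + 1]) = (\<lambda>t. - f t) ` h ` {1..T}"
      by (auto simp del: upt_Suc)
    then show ?thesis using that by (simp add: permutes_image)
  qed
  have "map (\<lambda>k. - f (\<pi> k)) [1..<T + 1] = map (\<lambda>k. - f (\<pi>' k)) [1..<T + 1]"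
    using sorted set P by (intro strict_sorted_equal) auto
  then have "f (\<pi> k) = f (\<pi>' k)" if "k \<in> {1..T}" for k
    using that by (auto simp del: upt_Suc)
  moreover have "\<pi> k \<in> {1..T}" "\<pi>' k \<in> {1..T}" if "k \<in> {1..T}" for k
    using P that by (simp_all only: permutes_in_image)
  ultimately have "\<pi> k = \<pi>' k" if "k \<in> {1..T}" for k
    using that inj by (simp add: inj_on_eq_iff)
  moreover have "\<pi> k = \<pi>' k" if "k \<notin> {1..T}" for k
    using P that by (metis permutes_not_in)
  ultimately show "\<pi> = \<pi>'" by (intro ext) blast
qed

section \<open>The order of the lines along a ray\<close>

lemma tan_pos_of_angle: "\<alpha> \<in> {0<..<pi/2} \<Longrightarrow> 0 < tan \<alpha>"
  by (auto intro: tan_gt_zero)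

text \<open>Substituting \<open>z2 = z1 * tan \<alpha>\<close> into the equation of the line leaves
  a linear equation in \<open>z1\<close> with positive coefficient, whose solution lies in the
  quadrant.\<close>

lemma meeting_abscissa_eq:
  assumes "\<alpha> \<in> {0<..<pi/2}" "0 < fst c" "0 < snd c"
  shows "meeting_abscissa \<alpha> c = 1 / (fst c + snd c * tan \<alpha>)"
proof -
  have pos: "0 < fst c + snd c * tan \<alpha>"
    using assms tan_pos_of_angle by (simp add: add_pos_pos)
  have "(\<exists>z2. (z1, z2) \<in> ray \<alpha> \<inter> line c) \<longleftrightarrow> z1 = 1 / (fst c + snd c * tan \<alpha>)" for z1
  proof -
    have "fst c * z1 + snd c * (z1 * tan \<alpha>) = z1 * (fst c + snd c * tan \<alpha>)"
      by (simp add: algebra_simps)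
    then have "(\<exists>z2. (z1, z2) \<in> ray \<alpha> \<inter> line c) \<longleftrightarrow>
        0 \<le> z1 \<and> 0 \<le> z1 * tan \<alpha> \<and> z1 = 1 / (fst c + snd c * tan \<alpha>)"
      using pos by (auto simp: ray_def line_def R2plus_def eq_divide_eq)
    then show ?thesis
      using pos tan_pos_of_angle[OF assms(1)] by auto
  qed
  then show ?thesis by (simp add: meeting_abscissa_def)
qed

text \<open>The abscissas are the reciprocals of these sums, so their decrease becomes an increase.
  They are distinct because a regular ray avoids all intersection points.\<close>

lemma line_order_strict:
  assumes \<alpha>: "\<alpha> \<in> regular_angles T q"
    and q: "\<And>t. t \<in> {1..T} \<Longrightarrow> 0 < fst (q t) \<and> 0 < snd (q t)"
    and jk: "j \<in> {1..T}" "k \<in> {1..T}" "j < k"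
  shows "fst (q (line_order T q \<alpha> j)) + snd (q (line_order T q \<alpha> j)) * tan \<alpha>
       < fst (q (line_order T q \<alpha> k)) + snd (q (line_order T q \<alpha> k)) * tan \<alpha>"
proof -
  have angle: "\<alpha> \<in> {0<..<pi/2}"
    using \<alpha> by (simp add: regular_angles_def)
  let ?D = "\<lambda>t. fst (q t) + snd (q t) * tan \<alpha>"
  have D_pos: "0 < ?D t" if "t \<in> {1..T}" for t
    using q[OF that] tan_pos_of_angle[OF angle] by (simp add: add_pos_pos)
  have abscissa: "meeting_abscissa \<alpha> (q t) = 1 / ?D t" if "t \<in> {1..T}" for t
    using meeting_abscissa_eq angle q that by simp
  have "inj_on (\<lambda>t. meeting_abscissa \<alpha> (q t)) {1..T}"
  proof (rule inj_onI, rule ccontr)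
    fix s t assume st: "s \<in> {1..T}" "t \<in> {1..T}" "s \<noteq> t"
      and "meeting_abscissa \<alpha> (q s) = meeting_abscissa \<alpha> (q t)"
    then have eq: "?D s = ?D t" using abscissa by simp
    \<comment> \<open>With equal denominators both lines meet the ray in this one point, an
      intersection point excluded by regularity.\<close>
    let ?z = "(1 / ?D t, 1 / ?D t * tan \<alpha>)"
    have "fst (q r) * (1 / ?D t) + snd (q r) * (1 / ?D t * tan \<alpha>) = ?D r / ?D t" for r
      by (simp add: add_divide_distrib)
    then have "?z \<in> line (q s)" "?z \<in> line (q t)"
      using eq D_pos[OF st(2)] by (simp_all add: line_def)
    then have "?z \<in> intersection_points T q"
      using st unfolding intersection_points_def by blast
    moreover have "?z \<in> ray \<alpha>"
      using D_pos[OF st(2)] tan_pos_of_angle[OF angle] by (simp add: ray_def R2plus_def)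
    ultimately show False
      using \<alpha> by (auto simp: regular_angles_def critical_angles_def)
  qed
  from theI'[OF ex1_decreasing_permutation[OF this]]
  have \<pi>: "line_order T q \<alpha> permutes {1..T}"
    and less: "meeting_abscissa \<alpha> (q (line_order T q \<alpha> k)) < meeting_abscissa \<alpha> (q (line_order T q \<alpha> j))"
    using jk by (auto simp: line_order_def)
  have mem: "line_order T q \<alpha> j \<in> {1..T}" "line_order T q \<alpha> k \<in> {1..T}"
    using \<pi> jk by (simp_all only: permutes_in_image)
  show ?thesis
    using less D_pos[OF mem(1)] D_pos[OF mem(2)] abscissa[OF mem(1)] abscissa[OF mem(2)]
    by (simp add: divide_less_cancel frac_less2 field_simps)
qed

section \<open>From nested initial segments to a solution of the moment problem\<close>

lemma ex_separating_values:
  fixes G :: "nat \<Rightarrow> real"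
  assumes pos: "\<And>j. j \<in> {1..T} \<Longrightarrow> 0 < G j"
    and less: "\<And>j k. j \<in> {1..T} \<Longrightarrow> k \<in> {1..T} \<Longrightarrow> j < k \<Longrightarrow> G j < G k"
    and k: "k \<in> {1..T}"
  shows "\<exists>u>0. \<forall>j\<in>{1..T}. if j \<le> k then G j < u else u < G j"
proof -
  have mono: "G i \<le> G j" if "i \<in> {1..T}" "j \<in> {1..T}" "i \<le> j" for i j
    using less[of i j] that by (cases "i = j") auto
  show ?thesis
  proof (cases "k = T")
    case True
    \<comment> \<open>There is no next value to stay below, so any number above \<open>G T\<close>
      serves.\<close>
    have "G j < G T + 1" if "j \<in> {1..T}" for j
      using mono[of j T] that by fastforce
    then show ?thesis
      using True pos[OF k] by (intro exI[of _ "G T + 1"]) auto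
  next
    case False
    then have "k + 1 \<in> {1..T}" using k by auto
    then obtain u where u: "G k < u" "u < G (k + 1)"
      using less[of k "k + 1"] k dense by auto
    have "if j \<le> k then G j < u else u < G j" if "j \<in> {1..T}" for j
      using mono[of j k] mono[of "k + 1" j] u that k \<open>k + 1 \<in> {1..T}\<close> by auto
    then show ?thesis
      using u pos[OF k] by (intro exI[of _ u]) auto
  qed
qed

text \<open>At \<open>x k\<close> exactly the integrands numbered \<open>l 1, ..., l k\<close> equal
  1. The inequalities in \<open>sep\<close> are strict, so by continuity these values persist near
  \<open>x k\<close>, where mass can be spread.\<close>

lemma moment_problem_solvable_of_nested:
  assumes p: "\<And>t. t \<in> {1..T} \<Longrightarrow> 0 < fst (p t) \<and> 0 < snd (p t)"
    and y: "\<And>t. t \<in> {1..T} \<Longrightarrow> 0 \<le> y t"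
    and l: "l permutes {1..T}"
    and y_less: "\<And>k. k \<in> {1..<T} \<Longrightarrow> y (l (k + 1)) < y (l k)"
    and x: "\<And>k. k \<in> {1..T} \<Longrightarrow> 0 < fst (x k) \<and> 0 < snd (x k)"
    and sep: "\<And>j k. j \<in> {1..T} \<Longrightarrow> k \<in> {1..T} \<Longrightarrow>
      if j \<le> k then ces \<rho> (p (l j)) (x k) < p0 (l j) else p0 (l j) < ces \<rho> (p (l j)) (x k)"
  shows "moment_problem_solvable T \<rho> y p0 p"
proof -
  have l_mem: "l j \<in> {1..T}" if "j \<in> {1..T}" for j
    using l that by (simp only: permutes_in_image)
  have "\<exists>B. open B \<and> bounded B \<and> B \<noteq> {} \<and> B \<subseteq> R2plus \<and>
      (\<forall>z\<in>B. \<forall>j\<in>{1..T}. theta (p0 (l j) - ces \<rho> (p (l j)) z) = of_bool (j \<le> k))"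
    if k: "k \<in> {1..T}" for k
  proof -
    have "\<forall>\<^sub>F z in nhds (x k). theta (p0 (l j) - ces \<rho> (p (l j)) z) = of_bool (j \<le> k)"
      if j: "j \<in> {1..T}" for j
    proof -
      have cont: "(ces \<rho> (p (l j)) \<longlongrightarrow> ces \<rho> (p (l j)) (x k)) (nhds (x k))"
        using isCont_ces p[OF l_mem[OF j]] x[OF k]
        by (simp add: isCont_def tendsto_at_iff_tendsto_nhds)
      show ?thesis
      proof (cases "j \<le> k")
        case True
        then have "\<forall>\<^sub>F z in nhds (x k). ces \<rho> (p (l j)) z < p0 (l j)"
          using cont sep[OF j k] by (intro order_tendstoD) auto
        then show ?thesis
          by eventually_elim (use True in \<open>simp add: theta_def\<close>)
      next
        case False
        then have "\<forall>\<^sub>F z in nhds (x k). p0 (l j) < ces \<rho> (p (l j)) z"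
          using cont sep[OF j k] by (intro order_tendstoD) auto
        then show ?thesis
          by eventually_elim (use False in \<open>simp add: theta_def\<close>)
      qed
    qed
    then have "\<forall>\<^sub>F z in nhds (x k). \<forall>j\<in>{1..T}.
        theta (p0 (l j) - ces \<rho> (p (l j)) z) = of_bool (j \<le> k)"
      by (intro eventually_ball_finite) auto
    then obtain U where U: "open U" "x k \<in> U"
      "\<forall>z\<in>U. \<forall>j\<in>{1..T}. theta (p0 (l j) - ces \<rho> (p (l j)) z) = of_bool (j \<le> k)"
      unfolding eventually_nhds by blast
    \<comment> \<open>Cutting with the open quadrant and a ball keeps the neighbourhood inside
      \<open>R2plus\<close> and bounded.\<close>
    let ?Q = "{z :: real \<times> real. 0 < fst z \<and> 0 < snd z}"
    have "open ?Q"
      by (intro open_Collect_conj open_Collect_less continuous_intros)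
    then have "open (U \<inter> ?Q \<inter> ball (x k) 1)" "bounded (U \<inter> ?Q \<inter> ball (x k) 1)"
      using U(1) by (auto intro: bounded_subset[OF bounded_ball])
    moreover have "x k \<in> U \<inter> ?Q \<inter> ball (x k) 1"
      using U(2) x[OF k] by auto
    moreover have "U \<inter> ?Q \<inter> ball (x k) 1 \<subseteq> R2plus"
      by (auto simp: R2plus_def)
    ultimately show ?thesis
      using U(3) by (intro exI[of _ "U \<inter> ?Q \<inter> ball (x k) 1"]) blast
  qed
  then obtain B where B: "\<And>k. k \<in> {1..T} \<Longrightarrow>
      open (B k) \<and> bounded (B k) \<and> B k \<noteq> {} \<and> B k \<subseteq> R2plus"
    and B_theta: "\<And>k z j. k \<in> {1..T} \<Longrightarrow> z \<in> B k \<Longrightarrow> j \<in> {1..T} \<Longrightarrow>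
      theta (p0 (l j) - ces \<rho> (p (l j)) z) = of_bool (j \<le> k)"
    by metis
  \<comment> \<open>The value after the last one is taken to be 0, so that
    \<open>m T = y (l T)\<close>.\<close>
  define m where "m k = y (l k) - (if k = T then 0 else y (l (k + 1)))" for k
  have m: "0 \<le> m k" if "k \<in> {1..T}" for k
    using that y[OF l_mem[OF that]] y_less[of k] by (auto simp: m_def intro: less_imp_le)
  have "R2plus \<in> sets borel"
    unfolding R2plus_def
    by (intro borel_closed closed_Collect_conj closed_Collect_le continuous_intros)
  \<comment> \<open>Time \<open>t\<close> has position \<open>inv l t\<close> in the order given by
    \<open>l\<close>.\<close>
  moreover have "theta (p0 t - ces \<rho> (p t) z) = of_bool (inv l t \<le> k)"
    if "t \<in> {1..T}" "k \<in> {1..T}" "z \<in> B k" for t k z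
  proof -
    have "inv l t \<in> {1..T}"
      using permutes_inv[OF l] that(1) by (simp only: permutes_in_image)
    then show ?thesis
      using B_theta[OF that(2,3), of "inv l t"] permutes_inverses(1)[OF l] by simp
  qed
  ultimately have "\<exists>\<mu>. sets \<mu> = sets (restrict_space lborel R2plus) \<and> sigma_finite_measure \<mu> \<and>
    absolutely_continuous (restrict_space lborel R2plus) \<mu> \<and>
    (\<forall>t\<in>{1..T}. has_bochner_integral \<mu> (\<lambda>z. theta (p0 t - ces \<rho> (p t) z))
      (\<Sum>k\<in>{1..T}. m k * of_bool (inv l t \<le> k)))"
    using B m
    by (intro ex_absolutely_continuous_measure_with_integrals[where B = B]) auto
  moreover have "(\<Sum>k\<in>{1..T}. m k * of_bool (inv l t \<le> k)) = y t" if "t \<in> {1..T}" for t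
  proof -
    define j where "j = inv l t"
    have j: "j \<in> {1..T}" "l j = t"
      using permutes_inv[OF l] that permutes_inverses(1)[OF l]
      by (simp_all only: permutes_in_image j_def)
    \<comment> \<open>Only the terms from \<open>j\<close> on survive; splitting off
      \<open>m T\<close> leaves a telescoping sum.\<close>
    have "(\<Sum>k\<in>{1..T}. m k * of_bool (j \<le> k)) = (\<Sum>k\<in>{j..T}. m k)"
      using j by (intro sum.mono_neutral_cong_right) auto
    also have "\<dots> = y (l j)"
    proof -
      have "j \<le> T" using j by simp
      then have "(\<Sum>k\<in>{j..T}. m k) = (\<Sum>k\<in>{j..<T}. m k) + m T"
        by (simp add: sum.last_plus add.commute)
      also have "(\<Sum>k\<in>{j..<T}. m k) = - (\<Sum>k\<in>{j..<T}. y (l (Suc k)) - y (l k))"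
        by (auto simp: m_def sum_negf[symmetric] intro!: sum.cong)
      also have "\<dots> = - (y (l T) - y (l j))"
        using sum_Suc_diff'[OF \<open>j \<le> T\<close>, of "\<lambda>k. y (l k)"] by simp
      finally show ?thesis by (simp add: m_def)
    qed
    finally show ?thesis using j by (simp add: j_def)
  qed
  ultimately show ?thesis
    unfolding moment_problem_solvable_def by simp
qed

section \<open>From a snake of the tiling to separating points on a ray\<close>

theorem proposition6p3:
  fixes T :: nat and \<rho> \<epsilon> :: real
    and y p0 :: "nat \<Rightarrow> real" and p :: "nat \<Rightarrow> real \<times> real"
    and l :: "nat \<Rightarrow> nat"
  assumes "T \<ge> 1"
    and "\<rho> \<in> {-1..<0} \<union> {0<..}"
    and "\<And>t. t \<in> {1..T} \<Longrightarrow> y t \<ge> 0"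
    and "\<And>t. t \<in> {1..T} \<Longrightarrow> p0 t > 0"
    and "\<And>t. t \<in> {1..T} \<Longrightarrow> fst (p t) > 0 \<and> snd (p t) > 0"
    and "\<rho> > 0 \<Longrightarrow> admissible_eps T \<rho> p0 p \<epsilon>"
    and "well_numbered T (p_tilde \<rho> \<epsilon> p0 p)"
    and "general_position T (p_tilde \<rho> \<epsilon> p0 p)"
    and "l permutes {1..T}"
    and "\<And>k. k \<in> {1..<T} \<Longrightarrow> y (l (k + 1)) < y (l k)"
    and "has_snake (tiling T (p_tilde \<rho> \<epsilon> p0 p)) (snake T l)"
  shows "moment_problem_solvable T \<rho> y p0 p"
proof -
  let ?q = "p_tilde \<rho> \<epsilon> p0 p"
  note p0 = assms(4) and p = assms(5) and l = assms(9)
  have \<rho>: "\<rho> \<noteq> 0" using assms(2) by auto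
  obtain \<alpha> where \<alpha>: "\<alpha> \<in> regular_angles T ?q" and sn: "snake T l = snake T (line_order T ?q \<alpha>)"
    using assms(11) by (auto simp: has_snake_def tiling_def)
  have tan: "0 < tan \<alpha>"
    using \<alpha> tan_pos_of_angle by (simp add: regular_angles_def)
  have l_mem: "l j \<in> {1..T}" if "j \<in> {1..T}" for j
    using l that by (simp only: permutes_in_image)
  \<comment> \<open>For \<open>\<rho> < 0\<close> this is
    \<open>fst (?q t) + snd (?q t) * tan \<alpha>\<close>; for \<open>\<rho> > 0\<close> that sum
    equals \<open>(1 + tan \<alpha>) / \<epsilon> - c t\<close>, which reverses the order.\<close>
  define c where
    "c t = fst (p_hat p0 p t) powr (-\<rho>) + snd (p_hat p0 p t) powr (-\<rho>) * tan \<alpha>" for t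
  have c_pos: "0 < c t" if "t \<in> {1..T}" for t
    using p0[OF that] p[OF that] tan by (auto simp: c_def p_hat_def intro!: add_pos_pos)
  \<comment> \<open>For \<open>\<rho> > 0\<close> positivity is the bound by
    \<open>1/\<epsilon>\<close> in \<open>admissible_eps\<close>.\<close>
  have "0 < fst (?q t) \<and> 0 < snd (?q t)" if "t \<in> {1..T}" for t
    using p0[OF that] p[OF that] assms(6) that \<rho>
    by (auto simp: p_tilde_def p_hat_def admissible_eps_def)
  then have "fst (?q (l j)) + snd (?q (l j)) * tan \<alpha> < fst (?q (l k)) + snd (?q (l k)) * tan \<alpha>"
    if "j \<in> {1..T}" "k \<in> {1..T}" "j < k" for j k
    using line_order_strict[OF \<alpha> _ that] snake_eq_imp_eq[OF sn that(1)]
      snake_eq_imp_eq[OF sn that(2)] by simp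
  then have c_less: "if \<rho> < 0 then c (l j) < c (l k) else c (l k) < c (l j)"
    if "j \<in> {1..T}" "k \<in> {1..T}" "j < k" for j k
    using that by (fastforce simp: c_def p_tilde_def algebra_simps)

  \<comment> \<open>The substitution \<open>z_i = x_i^(-\<rho>)\<close> takes \<open>e\<close> to
    \<open>(1, tan \<alpha>)\<close>, a point of the ray \<open>R_\<alpha>\<close>.\<close>
  define e where "e = (1 :: real, tan \<alpha> powr (-1/\<rho>))"
  have e_pos: "0 < fst e" "0 < snd e"
    using tan by (simp_all add: e_def)
  \<comment> \<open>\<open>G j\<close> is the value of \<open>ces\<close> at \<open>e\<close> for
    the normalised prices \<open>p_hat\<close>; on the ray through \<open>e\<close> the integrand
    \<open>l j\<close> drops to 0 beyond the scale \<open>1 / G j\<close>.\<close>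
  define G where "G j = c (l j) powr (-1/\<rho>)" for j
  have ces_e: "ces \<rho> (p (l j)) e = p0 (l j) * G j" if "j \<in> {1..T}" for j
  proof -
    let ?t = "l j"
    have p0t: "0 < p0 ?t" and pt: "0 < fst (p ?t)" "0 < snd (p ?t)"
      using p0 p l_mem[OF that] by auto
    have "fst (p ?t) powr (-\<rho>) * fst e powr (-\<rho>) + snd (p ?t) powr (-\<rho>) * snd e powr (-\<rho>) =
        p0 ?t powr (-\<rho>) * c ?t"
      using p0t pt tan \<rho> by (simp add: e_def c_def p_hat_def powr_divide powr_powr field_simps)
    then have "ces \<rho> (p ?t) e = (p0 ?t powr (-\<rho>) * c ?t) powr (-1/\<rho>)"
      using e_pos by (simp add: ces_def)
    then show ?thesis
      using p0t c_pos[OF l_mem[OF that]] \<rho> by (simp add: G_def powr_mult powr_powr)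
  qed
  have G_pos: "0 < G j" if "j \<in> {1..T}" for j
    using c_pos[OF l_mem[OF that]] by (simp add: G_def)
  \<comment> \<open>Both signs of \<open>\<rho>\<close> give the same order: \<open>c\<close>
    increases and the exponent \<open>-1/\<rho>\<close> is positive, or \<open>c\<close> decreases
    and the exponent is negative.\<close>
  have G_less: "G j < G k" if "j \<in> {1..T}" "k \<in> {1..T}" "j < k" for j k
  proof (cases "\<rho> < 0")
    case True
    then show ?thesis
      using c_less[OF that] c_pos[OF l_mem[OF that(1)]]
      by (simp add: G_def powr_less_mono2 divide_neg_neg)
  next
    case False
    then show ?thesis
      using c_less[OF that] c_pos[OF l_mem[OF that(2)]] \<rho>
      by (simp add: G_def powr_less_mono2_neg)
  qed
  have "\<forall>k\<in>{1..T}. \<exists>u>0. \<forall>j\<in>{1..T}. if j \<le> k then G j < u else u < G j"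
    using ex_separating_values[of T G] G_pos G_less by blast
  then obtain u where u_all: "\<forall>k\<in>{1..T}. 0 < u k \<and>
      (\<forall>j\<in>{1..T}. if j \<le> k then G j < u k else u k < G j)"
    by (auto dest!: bchoice)
  then have u: "0 < u k" if "k \<in> {1..T}" for k
    using that by blast
  from u_all have u_sep: "if j \<le> k then G j < u k else u k < G j"
    if "j \<in> {1..T}" "k \<in> {1..T}" for j k
    using that by blast
  show ?thesis
  proof (rule moment_problem_solvable_of_nested[OF p assms(3) l assms(10)])
    show "0 < fst ((1 / u k) *\<^sub>R e) \<and> 0 < snd ((1 / u k) *\<^sub>R e)" if "k \<in> {1..T}" for k
      using u[OF that] e_pos by simp
    show "if j \<le> k then ces \<rho> (p (l j)) ((1 / u k) *\<^sub>R e) < p0 (l j)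
        else p0 (l j) < ces \<rho> (p (l j)) ((1 / u k) *\<^sub>R e)"
      if "j \<in> {1..T}" "k \<in> {1..T}" for j k
    proof -
      \<comment> \<open>At scale \<open>1 / u k\<close> the comparison with \<open>p0 (l j)\<close>
        reduces to that of \<open>G j\<close> with \<open>u k\<close>.\<close>
      have "ces \<rho> (p (l j)) ((1 / u k) *\<^sub>R e) = p0 (l j) * G j / u k"
        using ces_scale[OF \<rho>, of "1 / u k" "p (l j)" e] p[OF l_mem[OF that(1)]] u[OF that(2)]
          e_pos ces_e[OF that(1)] by simp
      then show ?thesis
        using u_sep[OF that] u[OF that(2)] p0[OF l_mem[OF that(1)]]
        by (auto simp: divide_less_eq less_divide_eq split: if_splits)
    qed
  qed
qed

end
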